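(* If $G$ is a finite group, then the girth of $\Gamma(G)$ is either $4$ or infinite.
   Context: For a finite group $G$, the cyclic subgroup graph $\Gamma(G)$ is the simple undirected graph whose vertex set is $C(G)$, the set of all cyclic subgroups of $G$ (including the trivial subgroup $\{e\}$), and in which two distinct vertices are adjacent if and only if one of them, $H_1$, is contained in the other, $H_2$, and there is no subgroup $K$ of $G$ with $H_1<K<H_2$ (strict inclusions). The girth of a graph is the length of its smallest cycle, and is infinite if the graph contains no cycle. *)

theory Defs
  imports
    "HOL-Algebra.Elementary_Groups"
    "HOL-Library.Extended_Nat"
    "Graph_Theory.Pair_Digraph"
begin

definition cyclic_subgroups :: "('a, 'b) monoid_scheme \<Rightarrow> 'a set set" where
  "cyclic_subgroups G = {H. subgroup H G \<and> cyclic_group (G\<lparr>carrier := H\<rparr>)}"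

definition covered_by :: "('a, 'b) monoid_scheme \<Rightarrow> 'a set \<Rightarrow> 'a set \<Rightarrow> bool" where
  "covered_by G H\<^sub>1 H\<^sub>2 \<longleftrightarrow> H\<^sub>1 \<subset> H\<^sub>2 \<and> \<not> (\<exists>K. subgroup K G \<and> H\<^sub>1 \<subset> K \<and> K \<subset> H\<^sub>2)"

text \<open>A simple undirected graph is represented by a loop-free symmetric digraph without parallel
  arcs, each edge being given by its two arcs.\<close>

definition cyclic_subgroup_graph :: "('a, 'b) monoid_scheme \<Rightarrow> 'a set pair_pre_digraph" where
  "cyclic_subgroup_graph G =
    \<lparr> pverts = cyclic_subgroups G,
      parcs = {(H\<^sub>1, H\<^sub>2). H\<^sub>1 \<in> cyclic_subgroups G \<and> H\<^sub>2 \<in> cyclic_subgroups G \<and>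
                 (covered_by G H\<^sub>1 H\<^sub>2 \<or> covered_by G H\<^sub>2 H\<^sub>1)} \<rparr>"

text \<open>In a symmetric digraph, traversing an edge back and forth is a directed cycle of length
  two, but it is not a cycle of the underlying simple graph; all longer directed cycles are.
  The infimum of the empty set in \<^typ>\<open>enat\<close> is \<^term>\<open>\<infinity> :: enat\<close>.\<close>

definition girth :: "'a pair_pre_digraph \<Rightarrow> enat" where
  "girth \<Gamma> = (INF p \<in> {p. pre_digraph.cycle (with_proj \<Gamma>) p \<and> 3 \<le> length p}. enat (length p))"

lemma (in group) cyclic_subgroups_eq_generate:
  "cyclic_subgroups G = (\<lambda>x. generate G {x}) ` carrier G"
proof (intro Set.set_eqI iffI)
  fix H assume "H \<in> cyclic_subgroups G"
  then have H: "subgroup H G" and "cyclic_group (G\<lparr>carrier := H\<rparr>)"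
    by (auto simp: cyclic_subgroups_def)
  then obtain x where x: "x \<in> H"
    and eq: "subgroup_generated (G\<lparr>carrier := H\<rparr>) {x} = G\<lparr>carrier := H\<rparr>"
    by (auto simp: cyclic_group_def)
  from arg_cong[OF eq, of carrier] x have "generate (G\<lparr>carrier := H\<rparr>) {x} = H"
    by (simp add: carrier_subgroup_generated)
  moreover have "generate (G\<lparr>carrier := H\<rparr>) {x} = generate G {x}"
    using generate_consistent[of "{x}" H] H x by auto
  ultimately show "H \<in> (\<lambda>x. generate G {x}) ` carrier G"
    using subgroup.mem_carrier[OF H x] by auto
next
  fix H assume "H \<in> (\<lambda>x. generate G {x}) ` carrier G"
  then obtain x where x: "x \<in> carrier G" and H: "H = generate G {x}" by auto
  then have "subgroup_generated G {x} = G\<lparr>carrier := H\<rparr>"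
    by (simp add: subgroup_generated_def)
  then show "H \<in> cyclic_subgroups G"
    using cyclic_group_generated[of x] generate_is_subgroup[of "{x}"] x H
    by (simp add: cyclic_subgroups_def)
qed

lemma (in group) pair_graph_cyclic_subgroup_graph:
  assumes "finite (carrier G)"
  shows "pair_graph (cyclic_subgroup_graph G)"
proof -
  have fin: "finite (cyclic_subgroups G)"
    using assms by (simp add: cyclic_subgroups_eq_generate)
  have "parcs (cyclic_subgroup_graph G) \<subseteq> cyclic_subgroups G \<times> cyclic_subgroups G"
    by (auto simp: cyclic_subgroup_graph_def)
  then have "finite (parcs (cyclic_subgroup_graph G))"
    using fin by (meson finite_SigmaI finite_subset)
  with fin show ?thesis
    by unfold_locales
      (auto simp: cyclic_subgroup_graph_def covered_by_def symmetric_def sym_def)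
qed

lemma girth_eq_infinity_iff:
  "girth \<Gamma> = \<infinity> \<longleftrightarrow> \<not> (\<exists>p. pre_digraph.cycle (with_proj \<Gamma>) p \<and> 3 \<le> length p)"
proof
  assume inf: "girth \<Gamma> = \<infinity>"
  show "\<not> (\<exists>p. pre_digraph.cycle (with_proj \<Gamma>) p \<and> 3 \<le> length p)"
  proof
    assume "\<exists>p. pre_digraph.cycle (with_proj \<Gamma>) p \<and> 3 \<le> length p"
    then obtain p where "pre_digraph.cycle (with_proj \<Gamma>) p \<and> 3 \<le> length p" ..
    then have "girth \<Gamma> \<le> enat (length p)"
      unfolding girth_def by (intro INF_lower) simp
    with inf show False by simp
  qed
next
  assume "\<not> (\<exists>p. pre_digraph.cycle (with_proj \<Gamma>) p \<and> 3 \<le> length p)"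
  then have "{p. pre_digraph.cycle (with_proj \<Gamma>) p \<and> 3 \<le> length p} = {}" (is "?C = _")
    by blast
  then have "(\<lambda>p. enat (length p)) ` ?C = {}" by (simp only: image_empty)
  then show "girth \<Gamma> = \<infinity>" unfolding girth_def by (simp only: Inf_empty top_enat_def)
qed

end

theory Submission
  imports Defs
begin

text \<open>A vertex of maximal order on a cycle of length at least three contains both of its
  neighbours on the cycle. It is thus a cyclic group \<open>H\<close> with two distinct maximal subgroups
  \<open>A\<close> and \<open>B\<close>. Since \<open>H\<close> is abelian, the modular law shows that \<open>A \<inter> B\<close> is a maximal
  subgroup of both \<open>A\<close> and \<open>B\<close> (lemma \<open>covered_by_Int\<close>). It is cyclic, being a subgroup of a
  cyclic group, so that \<open>H\<close>, \<open>A\<close>, \<open>A \<inter> B\<close>, \<open>B\<close> is a cycle of length four. On the other hand,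
  there is no triangle (lemma \<open>cyclic_subgroup_graph_no_triangle\<close>): its vertices would form a chain
  in which the largest covers the smallest despite the third lying strictly between.\<close>

section \<open>Subgroups of cyclic groups\<close>

lemma (in group) cyclic_subgroups_subgroup:
  assumes H: "H \<in> cyclic_subgroups G" and K: "subgroup K G" and KH: "K \<subseteq> H"
  shows "K \<in> cyclic_subgroups G"
proof -
  obtain x where x: "x \<in> carrier G" and Hx: "H = generate G {x}"
    using H by (auto simp: cyclic_subgroups_eq_generate)
  have pow_K: "y [^] n \<in> K" if "y \<in> K" for y and n :: int
    using that K by (simp add: subgroup_int_pow_closed)
  \<comment> \<open>The exponent of a generator; when \<open>K\<close> is trivial and \<open>x\<close> has infinite order, no positive
    exponent exists and \<open>0\<close> serves instead.\<close>
  define P where "P m \<longleftrightarrow> 0 < m \<and> x [^] int m \<in> K" for m :: nat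
  define d where "d = (if \<exists>m. P m then LEAST m. P m else 0)"
  have d: "x [^] int d \<in> K"
  proof (cases "\<exists>m. P m")
    case True
    then have "P d" by (auto simp: d_def intro: LeastI)
    then show ?thesis by (simp add: P_def)
  next
    case False
    then show ?thesis using subgroup.one_closed[OF K] by (simp add: d_def)
  qed
  have least: "r = 0" if "x [^] int r \<in> K" "d \<noteq> 0 \<Longrightarrow> r < d" for r
  proof (rule ccontr)
    assume "r \<noteq> 0"
    with that(1) have P: "P r" by (simp add: P_def)
    then have "P d" and "d \<le> r" by (auto simp: d_def intro: LeastI Least_le)
    then show False using that(2) by (auto simp: P_def)
  qed
  have mult: "int d dvd n" if n: "x [^] n \<in> K" for n
  proof (cases "d = 0")
    case True
    have "x [^] int (nat \<bar>n\<bar>) \<in> K"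
    proof (cases "0 \<le> n")
      case False
      then show ?thesis
        using subgroup.m_inv_closed[OF K n] x by (simp add: int_pow_neg)
    qed (use n in simp)
    then have "nat \<bar>n\<bar> = 0" using least True by blast
    then show ?thesis by simp
  next
    case False
    have "x [^] (n mod int d) = x [^] n \<otimes> (x [^] int d) [^] (- (n div int d))"
      using x by (simp add: int_pow_pow int_pow_mult flip: minus_mult_div_eq_mod)
        (simp add: int_pow_diff int_pow_neg)
    then have "x [^] (n mod int d) \<in> K"
      using subgroup.m_closed[OF K n pow_K[OF d]] by simp
    moreover have "nat (n mod int d) < d"
      using False by (simp add: nat_less_iff)
    ultimately have "nat (n mod int d) = 0"
      using least[of "nat (n mod int d)"] False by simp
    moreover have "0 \<le> n mod int d" using False by simp
    ultimately have "n mod int d = 0" by linarith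
    then show ?thesis by (rule mod_0_imp_dvd)
  qed
  have "K = generate G {x [^] int d}"
  proof
    show "K \<subseteq> generate G {x [^] int d}"
    proof
      fix y assume y: "y \<in> K"
      then obtain n :: int where n: "y = x [^] n"
        using KH Hx generate_pow[OF x] by auto
      then obtain q where "n = int d * q" using mult y by (metis dvdE)
      then show "y \<in> generate G {x [^] int d}"
        using n x generate_pow[of "x [^] int d"] by (auto simp: int_pow_pow)
    qed
    show "generate G {x [^] int d} \<subseteq> K"
      using d K by (simp add: generate_subgroup_incl)
  qed
  then show ?thesis using x by (auto simp: cyclic_subgroups_eq_generate)
qed

lemma (in group) cyclic_subgroups_comm_group:
  assumes "H \<in> cyclic_subgroups G"
  shows "comm_group (G\<lparr>carrier := H\<rparr>)"
  using assms subgroup.subgroup_is_group[OF _ is_group]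
  by (auto simp: cyclic_subgroups_def intro: group.cyclic_imp_abelian_group)

section \<open>Coverings in the subgroup lattice\<close>

text \<open>The diamond property: two distinct maximal subgroups of an abelian subgroup meet in a subgroup
  that is maximal in each of them.\<close>

lemma (in group) covered_by_Int:
  assumes A: "subgroup A G" and B: "subgroup B G" and H: "subgroup H G"
    and comm: "comm_group (G\<lparr>carrier := H\<rparr>)"
    and AH: "covered_by G A H" and BH: "covered_by G B H" and "A \<noteq> B"
  shows "covered_by G (A \<inter> B) A"
  unfolding covered_by_def
proof (intro conjI notI)
  have "\<not> A \<subseteq> B" using AH BH A B \<open>A \<noteq> B\<close> by (auto simp: covered_by_def)
  then show "A \<inter> B \<subset> A" by blast
  assume "\<exists>L. subgroup L G \<and> A \<inter> B \<subset> L \<and> L \<subset> A"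
  then obtain L where L: "subgroup L G" and AB_L: "A \<inter> B \<subset> L" and LA: "L \<subset> A" by blast
  have sub: "A \<subseteq> H" "B \<subseteq> H" "L \<subseteq> H" using AH BH LA by (auto simp: covered_by_def)
  have LB_H: "subgroup (L <#> B) (G\<lparr>carrier := H\<rparr>)"
    using comm_group.mult_subgroups[OF comm subgroup_incl[OF L H] subgroup_incl[OF B H]] sub
    by simp
  then have LB: "subgroup (L <#> B) G" using incl_subgroup[OF H] by blast
  have "B \<subseteq> L <#> B"
    using subgroup.one_closed[OF L] subgroup.mem_carrier[OF B]
    by (force simp: set_mult_def)
  moreover have "L <#> B \<subseteq> H" using subgroup.subset[OF LB_H] by simp
  ultimately consider "L <#> B = B" | "L <#> B = H"
    using BH LB unfolding covered_by_def by blast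
  then show False
  proof cases
    case 1
    have "L \<subseteq> L <#> B"
      using subgroup.one_closed[OF B] subgroup.mem_carrier[OF L]
      by (force simp: set_mult_def)
    then show False using 1 AB_L LA by blast
  next
    case 2
    \<comment> \<open>The modular law gives \<open>A = L (A \<inter> B) = L\<close>.\<close>
    have "A \<subseteq> L"
    proof
      fix a assume a: "a \<in> A"
      then obtain l b where l: "l \<in> L" and b: "b \<in> B" and eq: "a = l \<otimes> b"
        using 2 sub by (auto simp: set_mult_def)
      have "l \<in> A" using l LA by blast
      moreover have "b = inv l \<otimes> a"
        using eq l b subgroup.mem_carrier[OF L] subgroup.mem_carrier[OF B]
        by (simp add: inv_solve_left)
      ultimately have "b \<in> A"
        using a subgroup.m_closed[OF A] subgroup.m_inv_closed[OF A] by blast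
      then have "b \<in> L" using b AB_L by blast
      then show "a \<in> L" using eq l subgroup.m_closed[OF L] by blast
    qed
    then show False using LA by blast
  qed
qed

lemma arc_cyclic_subgroup_graph_iff:
  "(u, v) \<in> parcs (cyclic_subgroup_graph G) \<longleftrightarrow>
    u \<in> cyclic_subgroups G \<and> v \<in> cyclic_subgroups G \<and> (covered_by G u v \<or> covered_by G v u)"
  by (simp add: cyclic_subgroup_graph_def)

lemma cyclic_subgroup_graph_no_triangle:
  assumes "(u, v) \<in> parcs (cyclic_subgroup_graph G)"
    and "(v, w) \<in> parcs (cyclic_subgroup_graph G)"
    and "(w, u) \<in> parcs (cyclic_subgroup_graph G)"
  shows False
proof -
  have sub: "subgroup u G" "subgroup v G" "subgroup w G"
    using assms by (auto simp: arc_cyclic_subgroup_graph_iff cyclic_subgroups_def)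
  have chain: False if "subgroup b G" "covered_by G a b" "covered_by G b c" "covered_by G a c"
    for a b c using that by (auto simp: covered_by_def)
  have loop: False if "covered_by G a b" "covered_by G b c" "covered_by G c a" for a b c
    using that by (auto simp: covered_by_def)
  show False
    using assms unfolding arc_cyclic_subgroup_graph_iff
    by (elim conjE disjE) (blast intro: chain[OF sub(1)] chain[OF sub(2)] chain[OF sub(3)] loop)+
qed

section \<open>Maximal vertices on cycles\<close>

lemma pcas_fst_nth:
  assumes "pcas u p v" and "i < length p"
  shows "fst (p ! i) = (if i = 0 then u else snd (p ! (i - 1)))"
  using assms
proof (induction p arbitrary: u i)
  case (Cons e p)
  show ?case
  proof (cases i)
    case (Suc k)
    then have "fst (p ! k) = (if k = 0 then snd e else snd (p ! (k - 1)))"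
      using Cons.prems by (intro Cons.IH) auto
    then show ?thesis using Suc by (cases k) auto
  qed (use Cons.prems in simp)
qed simp

lemma pcas_snd_last: "pcas u p v \<Longrightarrow> p \<noteq> [] \<Longrightarrow> snd (last p) = v"
  by (induction u p v rule: pcas.induct) (auto split: if_splits)

text \<open>On a cycle of length at least three, a vertex maximising \<open>f\<close> has two different neighbours,
  on which \<open>f\<close> is no larger.\<close>

lemma cycle_max_vertex:
  fixes f :: "'a \<Rightarrow> nat"
  assumes cyc: "pre_digraph.cycle (with_proj \<Gamma>) p" and len: "3 \<le> length p"
  obtains u v w where "(u, v) \<in> parcs \<Gamma>" "(v, w) \<in> parcs \<Gamma>" "u \<noteq> w" "f u \<le> f v" "f w \<le> f v"
proof -
  let ?n = "length p"
  obtain x where aw: "pre_digraph.awalk (with_proj \<Gamma>) x p x"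
    and dist: "distinct (tl (pre_digraph.awalk_verts (with_proj \<Gamma>) x p))"
    using cyc by (auto simp: pre_digraph.cycle_def)
  then have cas: "pcas x p x" and arcs: "set p \<subseteq> parcs \<Gamma>"
    by (auto simp: pre_digraph.awalk_def cas_with_proj_eq)
  have "p \<noteq> []" using len by auto
  then have n_pos: "0 < ?n" by simp
  have distinct: "distinct (map snd p)"
    using dist pre_digraph.awalk_verts_conv'[of "with_proj \<Gamma>" x p x] cas \<open>p \<noteq> []\<close>
    by (simp add: cas_with_proj_eq)
  have last: "x = snd (p ! (?n - 1))"
    using pcas_snd_last[OF cas] \<open>p \<noteq> []\<close> by (simp add: last_conv_nth)
  \<comment> \<open>The vertices of the cycle, indexed cyclically.\<close>
  define s where "s i = snd (p ! (i mod ?n))" for i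
  have arc: "(s i, s (Suc i)) \<in> parcs \<Gamma>" for i
  proof -
    let ?j = "Suc i mod ?n"
    have j: "?j < ?n" using n_pos by (rule mod_less_divisor)
    have "fst (p ! ?j) = s i"
    proof (cases "Suc (i mod ?n) = ?n")
      case True
      then have "i mod ?n = ?n - 1" by simp
      then show ?thesis using pcas_fst_nth[OF cas j] last True by (simp add: s_def mod_Suc)
    next
      case False
      then show ?thesis using pcas_fst_nth[OF cas j] by (simp add: s_def mod_Suc)
    qed
    then have "p ! ?j = (s i, s (Suc i))" by (simp add: s_def prod_eq_iff)
    then show ?thesis using arcs nth_mem[OF j] by auto
  qed
  have "\<exists>k < ?n. \<forall>i < ?n. f (s i) \<le> f (s k)"
  proof -
    have fin: "finite ((\<lambda>i. f (s i)) ` {..<?n})" "(\<lambda>i. f (s i)) ` {..<?n} \<noteq> {}"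
      using n_pos by (simp, blast)
    from Max_in[OF this] obtain k where "k < ?n" "Max ((\<lambda>i. f (s i)) ` {..<?n}) = f (s k)" by auto
    then show ?thesis using Max_ge[OF fin(1)] by (metis imageI lessThan_iff)
  qed
  then obtain k where k: "k < ?n" and max: "\<And>i. i < ?n \<Longrightarrow> f (s i) \<le> f (s k)" by blast
  have s_mod: "s (i mod ?n) = s i" for i by (simp add: s_def)
  have max': "f (s i) \<le> f (s k)" for i
    using max[of "i mod ?n"] mod_less_divisor[OF n_pos, of i] by (simp add: s_mod)
  \<comment> \<open>The index \<open>k - 1\<close> modulo the length, avoiding truncated subtraction.\<close>
  let ?l = "k + (?n - 1)"
  have "Suc ?l = k + ?n" using n_pos by linarith
  then have k': "s (Suc ?l) = s k" unfolding s_def by (metis mod_add_self2)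
  have "?l mod ?n \<noteq> Suc k mod ?n"
  proof
    assume "?l mod ?n = Suc k mod ?n"
    moreover have "Suc k \<le> ?l" using len by linarith
    ultimately have "?n dvd ?l - Suc k" using mod_eq_dvd_iff_nat by blast
    moreover have "?l - Suc k = ?n - 2" by linarith
    ultimately have "?n dvd ?n - 2" by metis
    then have "?n \<le> ?n - 2" using len by (intro dvd_imp_le) linarith+
    then show False using len by linarith
  qed
  then have "s ?l \<noteq> s (Suc k)"
    using nth_eq_iff_index_eq[OF distinct, of "?l mod ?n" "Suc k mod ?n"]
      mod_less_divisor[OF n_pos] by (simp add: s_def del: mod_less_divisor)
  then show thesis
    using that[of "s ?l" "s k" "s (Suc k)"] arc[of ?l] arc[of k] max' k' by simp
qed

section \<open>Girth\<close>

lemma (in group) cyclic_subgroup_graph_four_cycle: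
  assumes fin: "finite (carrier G)"
    and cyc: "pre_digraph.cycle (with_proj (cyclic_subgroup_graph G)) p" and len: "3 \<le> length p"
  shows "\<exists>q. pre_digraph.cycle (with_proj (cyclic_subgroup_graph G)) q \<and> length q = 4"
proof -
  let ?\<Gamma> = "cyclic_subgroup_graph G"
  obtain A H B where AH: "(A, H) \<in> parcs ?\<Gamma>" and HB: "(H, B) \<in> parcs ?\<Gamma>" and "A \<noteq> B"
    and card: "card A \<le> card H" "card B \<le> card H"
    using cycle_max_vertex[OF cyc len, of card] by blast
  have cyclic: "A \<in> cyclic_subgroups G" "B \<in> cyclic_subgroups G" "H \<in> cyclic_subgroups G"
    using AH HB by (auto simp: arc_cyclic_subgroup_graph_iff)
  then have sub: "subgroup A G" "subgroup B G" "subgroup H G"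
    by (auto simp: cyclic_subgroups_def)
  have "\<not> covered_by G H K" if "subgroup K G" "card K \<le> card H" for K
    using that psubset_card_mono[of K H] finite_subset[OF subgroup.subset fin, of K]
    by (auto simp: covered_by_def)
  then have cov: "covered_by G A H" "covered_by G B H"
    using AH HB sub card by (auto simp: arc_cyclic_subgroup_graph_iff)
  let ?D = "A \<inter> B"
  have comm: "comm_group (G\<lparr>carrier := H\<rparr>)" by (rule cyclic_subgroups_comm_group) fact
  have covD: "covered_by G ?D A" "covered_by G ?D B"
    using covered_by_Int[OF sub comm cov \<open>A \<noteq> B\<close>]
      covered_by_Int[OF sub(2,1,3) comm cov(2,1)] \<open>A \<noteq> B\<close> by (auto simp: Int_commute)
  have D: "?D \<in> cyclic_subgroups G"
    using cyclic_subgroups_subgroup[OF cyclic(1) subgroups_Inter_pair[OF sub(1,2)]] by blast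
  let ?q = "[(H, A), (A, ?D), (?D, B), (B, H)]"
  have "set ?q \<subseteq> parcs ?\<Gamma>"
    using cyclic cov covD D by (simp add: arc_cyclic_subgroup_graph_iff)
  moreover have "distinct [A, ?D, B, H]"
    using cov covD \<open>A \<noteq> B\<close> unfolding covered_by_def by auto
  moreover have "H \<in> pverts ?\<Gamma>" using cyclic by (simp add: cyclic_subgroup_graph_def)
  ultimately have "pre_digraph.cycle (with_proj ?\<Gamma>) ?q"
    unfolding pre_digraph.cycle_def pre_digraph.awalk_def
    by (intro exI[of _ H]) (simp add: cas_with_proj_eq awalk_verts_with_proj_eq)
  then show ?thesis by (intro exI[of _ ?q]) simp
qed

lemma cyclic_subgroup_graph_cycle_length:
  assumes cyc: "pre_digraph.cycle (with_proj (cyclic_subgroup_graph G)) p" and len: "3 \<le> length p"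
  shows "4 \<le> length p"
proof (rule ccontr)
  assume "\<not> 4 \<le> length p"
  then have "length p = 3" using len by simp
  then obtain a b c where p: "p = [a, b, c]" by (auto simp: numeral_3_eq_3 length_Suc_conv)
  have "fst b = snd a \<and> fst c = snd b \<and> fst a = snd c \<and>
      set p \<subseteq> parcs (cyclic_subgroup_graph G)"
    using cyc unfolding p
    by (simp add: pre_digraph.cycle_def pre_digraph.awalk_def cas_with_proj_eq)
  then show False
    using cyclic_subgroup_graph_no_triangle[of "fst a" "fst b" G "fst c"] p
    by (metis insert_subset list.simps(15) prod.collapse)
qed

theorem corollary3p2:
  fixes G :: "('a, 'b) monoid_scheme"
  assumes "group G" and "finite (carrier G)"
  shows "girth (cyclic_subgroup_graph G) = 4 \<or> girth (cyclic_subgroup_graph G) = \<infinity>"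
proof (rule disjCI)
  let ?\<Gamma> = "cyclic_subgroup_graph G"
  assume "girth ?\<Gamma> \<noteq> \<infinity>"
  then obtain p where "pre_digraph.cycle (with_proj ?\<Gamma>) p" "3 \<le> length p"
    by (auto simp: girth_eq_infinity_iff)
  then obtain q where q: "pre_digraph.cycle (with_proj ?\<Gamma>) q" "length q = 4"
    using group.cyclic_subgroup_graph_four_cycle[OF assms] by blast
  have "girth ?\<Gamma> \<le> enat (length q)"
    unfolding girth_def using q by (intro INF_lower) simp
  moreover have "enat 4 \<le> girth ?\<Gamma>"
    unfolding girth_def using cyclic_subgroup_graph_cycle_length
    by (intro INF_greatest) (auto simp del: with_proj_simps)
  ultimately show "girth ?\<Gamma> = 4" using q by (simp add: numeral_eq_enat)
qed

end
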